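(* Let $t, r$ be integers with $1 \leq t \leq r$, let $k$ be a positive integer, and let $\mathcal{H}$ be a hereditary family with $\mu(\mathcal{H}) \geq n_{\rm S}(r,t)$. Let $\emptyset \neq S \subseteq [t,r]$ and $\mathcal{F} := \bigcup_{s \in S}\mathcal{H}^{(s)}$. Let $\mathcal{A}_1, \dots, \mathcal{A}_k$ be cross-$t$-intersecting subfamilies of $\mathcal{F}$, and let $\mathcal{L}$ be a largest $t$-star of $\mathcal{F}$. Then \[\sum_{i = 1}^k |\mathcal{A}_i| \leq \max\left\{ k|\mathcal{L}|, |\mathcal{F}| \right\}.\] Moreover, equality holds if and only if one of the following holds: (i) $|\mathcal{F}| < k|\mathcal{L}|$ and $\mathcal{A}_1 = \dots = \mathcal{A}_k = \mathcal{L}'$ for some largest $t$-star $\mathcal{L}'$ of $\mathcal{F}$; (ii) $|\mathcal{F}| > k |\mathcal{L}|$ and, for some $j \in [k]$, $\mathcal{A}_j = \mathcal{F}$ and $\mathcal{A}_i = \emptyset$ for all $i \in [k] \setminus \{j\}$; (iii) $|\mathcal{F}| = k |\mathcal{L}|$, and $\mathcal{A}_1, \dots, \mathcal{A}_k$ are as in (i) or (ii).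
   Context: All sets and families are finite; a family is a set of sets. For integers $m \le n$, $[m,n] := \{i \in \{1,2,\dots\} : m \le i \le n\}$ and $[n] := [1,n]$. A family $\mathcal{H}$ is hereditary if every subset of every member of $\mathcal{H}$ is a member of $\mathcal{H}$. A base of a family $\mathcal{F}$ is a set $B \in \mathcal{F}$ that is not a proper subset of any member of $\mathcal{F}$; $\mu(\mathcal{F})$ denotes the size of a smallest base of $\mathcal{F}$. For a family $\mathcal{F}$, $\mathcal{F}^{(s)} := \{F \in \mathcal{F} : |F| = s\}$. For a set $T$, $\mathcal{F}\langle T\rangle := \{F \in \mathcal{F} : T \subseteq F\}$; this is called a $t$-star of $\mathcal{F}$ if $|T| = t$, and a largest $t$-star of $\mathcal{F}$ is a $t$-star of $\mathcal{F}$ of maximum size among all $t$-stars of $\mathcal{F}$. A set $A$ $t$-intersects a set $B$ if $|A \cap B| \geq t$. Families $\mathcal{A}_1,\dots,\mathcal{A}_k$ are cross-$t$-intersecting if for all distinct $i,j \in [k]$, every set in $\mathcal{A}_i$ $t$-intersects every set in $\mathcal{A}_j$ (families may be empty or equal). Define $m(r,t) := \max\{2r, \frac{(r-t)(r-t+5)}{2} + (t-1)\}$ and $n_{\rm S}(r,t) := (r-t+1)\binom{m(r,t)}{t+1} + r$. *)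

theory Defs
  imports Complex_Main
begin

definition hereditary :: "'a set set \<Rightarrow> bool" where
  "hereditary H \<longleftrightarrow> (\<forall>A\<in>H. \<forall>B. B \<subseteq> A \<longrightarrow> B \<in> H)"

definition is_base :: "'a set set \<Rightarrow> 'a set \<Rightarrow> bool" where
  "is_base F B \<longleftrightarrow> B \<in> F \<and> \<not> (\<exists>A\<in>F. B \<subset> A)"

(* Meaningful only for finite nonempty families; those always have a base. *)
definition mu :: "'a set set \<Rightarrow> nat" where
  "mu F = Min (card ` {B. is_base F B})"

definition level :: "'a set set \<Rightarrow> nat \<Rightarrow> 'a set set" where
  "level F s = {A \<in> F. card A = s}"

definition star :: "'a set set \<Rightarrow> 'a set \<Rightarrow> 'a set set" where
  "star F T = {A \<in> F. T \<subseteq> A}"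

(* T is not required to be contained in a member of F, so a t-star may be empty. *)
definition is_star :: "nat \<Rightarrow> 'a set set \<Rightarrow> 'a set set \<Rightarrow> bool" where
  "is_star t F L \<longleftrightarrow> (\<exists>T. finite T \<and> card T = t \<and> L = star F T)"

definition largest_star :: "nat \<Rightarrow> 'a set set \<Rightarrow> 'a set set \<Rightarrow> bool" where
  "largest_star t F L \<longleftrightarrow> is_star t F L \<and> (\<forall>L'. is_star t F L' \<longrightarrow> card L' \<le> card L)"

definition t_intersects :: "nat \<Rightarrow> 'a set \<Rightarrow> 'a set \<Rightarrow> bool" where
  "t_intersects t A B \<longleftrightarrow> t \<le> card (A \<inter> B)"

definition cross_t_intersecting :: "nat \<Rightarrow> nat \<Rightarrow> (nat \<Rightarrow> 'a set set) \<Rightarrow> bool" where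
  "cross_t_intersecting t k \<A> \<longleftrightarrow>
     (\<forall>i\<in>{1..k}. \<forall>j\<in>{1..k}. i \<noteq> j \<longrightarrow> (\<forall>A\<in>\<A> i. \<forall>B\<in>\<A> j. t_intersects t A B))"

(* Used only for 1 \<le> t \<le> r, where no subtraction truncates; the division is exact
   because d * (d + 5) is always even. *)
definition m_bound :: "nat \<Rightarrow> nat \<Rightarrow> nat" where
  "m_bound r t = max (2 * r) ((r - t) * (r - t + 5) div 2 + (t - 1))"

definition n_S :: "nat \<Rightarrow> nat \<Rightarrow> nat" where
  "n_S r t = (r - t + 1) * (m_bound r t choose (t + 1)) + r"

end

theory Submission
  imports Defs
begin

text \<open>
  Let \<open>U\<close> be the union of the given families, let \<open>U\<^sub>0\<close> consist of the members of \<open>U\<close> that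
  \<open>t\<close>-intersect every member of \<open>U\<close>, and let \<open>U\<^sub>1 = U - U\<^sub>0\<close>. A set lying in two of the families
  belongs to \<open>U\<^sub>0\<close>, so the sum of the sizes is at most \<open>card U\<^sub>1 + k * card U\<^sub>0\<close>, and for nonempty
  \<open>U\<^sub>0\<close> it suffices to show \<open>card F * card U\<^sub>0 + card L * card U\<^sub>1 \<le> card F * card L\<close>.
  Exchanging an element of a star for an element of a base shows that a \<open>(t + 1)\<close>-star is smaller
  than the largest \<open>t\<close>-star, and the latter smaller than \<open>F\<close>, by a factor of about \<open>mu H / r\<close>.
  If \<open>U\<^sub>0\<close> is not contained in a \<open>t\<close>-star, all its members meet a fixed set of size at most
  \<open>m_bound r t\<close> in more than \<open>t\<close> points, so \<open>U\<^sub>0\<close> is covered by few \<open>(t + 1)\<close>-stars; if \<open>U\<^sub>0\<close> lies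
  in a \<open>t\<close>-star but \<open>U\<^sub>1\<close> does not lie in the same one, then \<open>r\<close> of the \<open>(t + 1)\<close>-stars suffice.
\<close>

section \<open>Covers by stars, and kernels of \<open>t\<close>-intersecting families\<close>

lemma card_le_cover:
  assumes "finite F" "finite \<T>" "\<And>T. T \<in> \<T> \<Longrightarrow> card (star F T) \<le> b"
    and "\<And>A. A \<in> G \<Longrightarrow> A \<in> F \<and> (\<exists>T\<in>\<T>. T \<subseteq> A)"
  shows "card G \<le> card \<T> * b"
proof -
  have "G \<subseteq> (\<Union>T\<in>\<T>. star F T)"
    using assms(4) by (auto simp: star_def)
  moreover have "finite (\<Union>T\<in>\<T>. star F T)"
    using assms(1,2) by (auto simp: star_def)
  ultimately have "card G \<le> card (\<Union>T\<in>\<T>. star F T)"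
    by (rule card_mono[rotated])
  also have "\<dots> \<le> (\<Sum>T\<in>\<T>. card (star F T))"
    using assms(2) by (rule card_UN_le)
  also have "\<dots> \<le> card \<T> * b"
    using sum_bounded_above[of \<T> "\<lambda>T. card (star F T)" b] assms(3) by simp
  finally show ?thesis .
qed

text \<open>Both traces lie in \<open>D \<inter> Z\<close>, which has room for at most
  \<open>t\<close> elements, so each of them fills it.\<close>

lemma inter_subset_if_small:
  assumes "finite D" "X \<subseteq> Z" "Y \<subseteq> Z" "card (D \<inter> Z) \<le> t"
    and "t \<le> card (D \<inter> X)" "t \<le> card (D \<inter> Y)"
  shows "D \<inter> X = D \<inter> Y"
proof -
  have "D \<inter> X = D \<inter> Z" using assms by (intro card_seteq) auto
  moreover have "D \<inter> Y = D \<inter> Z" using assms by (intro card_seteq) auto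
  ultimately show ?thesis by simp
qed

text \<open>If no two members meet in exactly \<open>t\<close> points, any single member serves as
  \<open>J\<close>. Otherwise \<open>J\<close> is the union of \<open>A\<close>, \<open>B\<close>
  with \<open>card (A \<inter> B) = t\<close> and some \<open>C\<close> not containing
  \<open>A \<inter> B\<close>: a \<open>D\<close> meeting \<open>J\<close> in at most
  \<open>t\<close> points would have the same trace on all three sets, and this trace would be
  \<open>A \<inter> B\<close>, inside \<open>C\<close>.\<close>

lemma nontrivial_kernel:
  assumes fin: "\<And>A. A \<in> G \<Longrightarrow> finite A \<and> card A \<le> r"
    and int: "\<And>A B. A \<in> G \<Longrightarrow> B \<in> G \<Longrightarrow> t \<le> card (A \<inter> B)"
    and nontriv: "\<And>T. finite T \<Longrightarrow> card T = t \<Longrightarrow> \<exists>A\<in>G. \<not> T \<subseteq> A"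
    and t: "1 \<le> t"
  obtains J where "finite J" "card J \<le> m_bound r t" "\<forall>D\<in>G. t + 1 \<le> card (D \<inter> J)"
proof (cases "\<exists>A\<in>G. \<exists>B\<in>G. card (A \<inter> B) = t")
  case False
  show thesis
  proof (cases "G = {}")
    case True
    then show thesis by (intro that[of "{}"]) auto
  next
    case nonempty: False
    then obtain A where A: "A \<in> G" by auto
    show thesis
    proof (rule that[of A])
      show "finite A" "card A \<le> m_bound r t"
        using fin[OF A] by (auto simp: m_bound_def)
      show "\<forall>D\<in>G. t + 1 \<le> card (D \<inter> A)"
        using False int A by (metis Suc_eq_plus1 Suc_leI le_neq_implies_less)
    qed
  qed
next
  case True
  then obtain A B where A: "A \<in> G" and B: "B \<in> G" and AB: "card (A \<inter> B) = t" by auto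
  have "finite (A \<inter> B)" using fin[OF A] by simp
  then obtain C where C: "C \<in> G" "\<not> A \<inter> B \<subseteq> C" using nontriv AB by blast
  have fins: "finite A" "finite B" "finite C" using fin A B C by auto
  have not_sub: "\<not> D \<inter> A \<subseteq> B \<inter> C" if D: "D \<in> G" for D
  proof
    assume *: "D \<inter> A \<subseteq> B \<inter> C"
    have "D \<inter> A = A \<inter> B"
      using * int[OF D A] AB fins by (intro card_seteq) auto
    then show False using * C by auto
  qed
  \<comment> \<open>This saves one element: with \<open>d = r - t\<close> the union has at most
    \<open>3 * d + (t - 1)\<close> elements, and \<open>d * (d + 5) div 2\<close> is at least
    \<open>3 * d\<close> once \<open>d\<close> is positive.\<close>
  have C_card: "t + 1 \<le> card (C \<inter> (A \<union> B))"
  proof (rule ccontr)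
    assume "\<not> ?thesis"
    then have "C \<inter> A = C \<inter> B"
      using int A B C fins by (intro inter_subset_if_small[of _ _ "A \<union> B" _ t]) auto
    then show False using not_sub[OF C(1)] by auto
  qed
  have "card (C \<inter> (A \<union> B)) + card (C - (A \<union> B)) = card C"
    using fins by (metis card_Int_Diff)
  moreover have "card (A \<union> B) + t = card A + card B"
    using card_Un_Int[of A B] fins AB by simp
  moreover have "card (A \<union> B \<union> C) \<le> card (A \<union> B) + card (C - (A \<union> B))"
    by (metis Un_Diff_cancel card_Un_le)
  moreover have "card A \<le> r" "card B \<le> r" "card C \<le> r" using fin A B C by auto
  ultimately have J: "card (A \<union> B \<union> C) + 2 * t + 1 \<le> 3 * r" "t + 1 \<le> r"
    using C_card by linarith+
  define d where "d = r - t"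
  have d: "r = t + d" "1 \<le> d" using J(2) by (auto simp: d_def)
  have "6 * d \<le> d * (d + 5)" using d by (cases d) auto
  then have "3 * d \<le> d * (d + 5) div 2" by linarith
  then have "card (A \<union> B \<union> C) \<le> m_bound r t"
    using J d t unfolding m_bound_def by simp
  moreover have "t + 1 \<le> card (D \<inter> (A \<union> B \<union> C))" if D: "D \<in> G" for D
  proof (rule ccontr)
    assume "\<not> ?thesis"
    then have "card (D \<inter> (A \<union> B \<union> C)) \<le> t" by simp
    moreover have "finite D" using fin[OF D] by simp
    ultimately have "D \<inter> A = D \<inter> X" if "X \<in> {B, C}" for X
      using int[OF D] A B C that by (intro inter_subset_if_small[of _ _ "A \<union> B \<union> C" _ t]) auto
    from this[of B] this[of C] have "D \<inter> A = D \<inter> B" "D \<inter> A = D \<inter> C" by simp_all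
    then show False using not_sub[OF D] by auto
  qed
  ultimately show thesis using fins by (intro that[of "A \<union> B \<union> C"]) auto
qed

text \<open>The left side is the term \<open>j = 1\<close> of Vandermonde's sum for
  \<open>2 * r\<close> choose \<open>t + 1\<close>. It lets \<open>M\<close> below absorb the number
  of \<open>t\<close>-subsets of a member of \<open>F\<close>, even multiplied by
  \<open>r\<close>.\<close>

lemma mult_choose_le_m_bound_choose:
  assumes "1 \<le> t" "t \<le> r"
  shows "r * (r choose t) \<le> m_bound r t choose (t + 1)"
proof -
  have "(r choose 1) * (r choose ((t + 1) - 1)) \<le> (\<Sum>j\<le>t + 1. (r choose j) * (r choose ((t + 1) - j)))"
    by (rule member_le_sum) auto
  also have "\<dots> = (r + r) choose (t + 1)"
    by (rule vandermonde)
  also have "\<dots> \<le> m_bound r t choose (t + 1)"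
    by (rule binomial_right_mono) (auto simp: m_bound_def)
  finally show ?thesis by simp
qed

section \<open>Hereditary families with large bases, and the exchange inequality\<close>

locale large_hereditary =
  fixes H F :: "'a set set" and S :: "nat set" and r t :: nat
  assumes t: "1 \<le> t" "t \<le> r"
    and finH: "finite H" and fin: "A \<in> H \<Longrightarrow> finite A"
    and her: "hereditary H" and ne: "H \<noteq> {}"
    and mu: "n_S r t \<le> mu H"
    and S: "S \<noteq> {}" "S \<subseteq> {t..r}"
    and F_def: "F = (\<Union>s\<in>S. level H s)"
begin

lemma memF: "A \<in> F \<longleftrightarrow> A \<in> H \<and> card A \<in> S"
  by (auto simp: F_def level_def)

lemma F_fin: "A \<in> F \<Longrightarrow> finite A" and F_card: "A \<in> F \<Longrightarrow> card A \<le> r"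
  and F_card_ge: "A \<in> F \<Longrightarrow> t \<le> card A"
  using S fin by (auto simp: memF)

lemma finF: "finite F"
  using finH by (rule rev_finite_subset) (auto simp: memF)

text \<open>A maximal superset of \<open>A\<close> within the finite family \<open>H\<close> is a
  base.\<close>

lemma extend:
  assumes "A \<in> H"
  obtains B where "B \<in> H" "A \<subseteq> B" "mu H \<le> card B"
proof -
  obtain B where B: "B \<in> H" "A \<subseteq> B" "\<forall>C\<in>H. B \<subseteq> C \<longrightarrow> C = B"
    using finite_has_maximal2[OF finH assms] by metis
  then have "is_base H B" by (auto simp: is_base_def)
  moreover have "finite {B. is_base H B}"
    using finH by (rule rev_finite_subset) (auto simp: is_base_def)
  ultimately have "mu H \<le> card B" unfolding mu_def by (intro Min_le) auto
  then show thesis using B that by blast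
qed

lemma mu_ge: "(r - t + 1) * (m_bound r t choose (t + 1)) + r \<le> mu H"
  using mu by (simp add: n_S_def)

text \<open>Double counting of exchanges of \<open>x\<close> for a new element \<open>y\<close>.
  Each \<open>A\<close> in \<open>X\<close> offers at least \<open>mu H - r\<close> choices of
  \<open>y\<close> inside a large superset \<open>E A\<close>; each resulting \<open>B\<close> in
  \<open>Y\<close> arises with at most \<open>r - card T\<close> values of \<open>y\<close>.\<close>

lemma star_exchange:
  assumes "x \<notin> T" "finite T"
  shows "(mu H - card T) * card (star F (insert x T)) \<le> (r - card T) * card (star F T)"
proof -
  define X Y where "X = star F (insert x T)" and "Y = {A \<in> star F T. x \<notin> A}"
  have finXY: "finite X" "finite Y" using finF by (auto simp: X_def Y_def star_def)
  obtain E where E: "\<And>A. A \<in> H \<Longrightarrow> E A \<in> H \<and> A \<subseteq> E A \<and> mu H \<le> card (E A)"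
  proof -
    have "\<forall>A. \<exists>B. A \<in> H \<longrightarrow> B \<in> H \<and> A \<subseteq> B \<and> mu H \<le> card B" using extend by metis
    then show thesis using that by metis
  qed
  have E_fin: "A \<in> H \<Longrightarrow> finite (E A)" for A using E fin by blast
  have XH: "A \<in> H" "A \<in> F" if "A \<in> X" for A using that by (auto simp: X_def star_def memF)
  have YH: "A \<in> H" "A \<in> F" if "A \<in> Y" for A using that by (auto simp: Y_def star_def memF)
  have "(mu H - r) * card X \<le> (\<Sum>A\<in>X. card (E A - A))"
  proof -
    have "mu H - r \<le> card (E A - A)" if "A \<in> X" for A
      using E[of A] XH[OF that] F_card[of A] F_fin[of A]
      by (subst card_Diff_subset) auto
    then show ?thesis
      using sum_bounded_below[of X "mu H - r" "\<lambda>A. card (E A - A)"] by (simp add: mult.commute)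
  qed
  also have "\<dots> = card (SIGMA A:X. E A - A)"
    using finXY XH E_fin by (subst card_SigmaI) auto
  also have "\<dots> \<le> card (SIGMA B:Y. B - T)"
  proof (rule card_inj_on_le)
    \<comment> \<open>The exchange keeps the size, so heredity keeps the result in \<open>F\<close>.
      Recording \<open>y\<close> makes the map invertible.\<close>
    let ?f = "\<lambda>(A, y). (insert y (A - {x}), y)"
    show "inj_on ?f (SIGMA A:X. E A - A)"
    proof (rule inj_on_inverseI[where g = "\<lambda>(B, y). (insert x (B - {y}), y)"])
      fix p assume "p \<in> (SIGMA A:X. E A - A)"
      then show "(\<lambda>(B, y). (insert x (B - {y}), y)) (?f p) = p"
        by (auto simp: X_def star_def)
    qed
    show "?f ` (SIGMA A:X. E A - A) \<subseteq> (SIGMA B:Y. B - T)"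
    proof (clarify, rule conjI)
      fix A y assume *: "A \<in> X" "y \<in> E A" "y \<notin> A"
      have A: "x \<in> A" "T \<subseteq> A" "finite A" "card A \<in> S"
        using * XH[OF *(1)] F_fin by (auto simp: X_def star_def memF)
      have "insert y (A - {x}) \<in> H"
        using E[OF XH(1)[OF *(1)]] * her unfolding hereditary_def
        by (meson Diff_subset insert_subset subset_trans)
      moreover have "card (insert y (A - {x})) = card A"
        using A * card_Suc_Diff1[of A x] by simp
      ultimately show "insert y (A - {x}) \<in> Y"
        using A * assms by (auto simp: Y_def star_def memF)
      show "y \<in> insert y (A - {x}) - T" using A * by auto
    qed
    show "finite (SIGMA B:Y. B - T)" using finXY YH F_fin by auto
  qed
  also have "\<dots> = (\<Sum>B\<in>Y. card (B - T))"
    using finXY YH F_fin by (subst card_SigmaI) auto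
  also have "\<dots> \<le> (r - card T) * card Y"
  proof -
    have "card (B - T) \<le> r - card T" if "B \<in> Y" for B
      using that F_card[OF YH(2)[OF that]] assms(2)
      by (subst card_Diff_subset) (auto simp: Y_def star_def)
    then show ?thesis
      using sum_bounded_above[of Y "\<lambda>B. card (B - T)" "r - card T"] by (simp add: mult.commute)
  qed
  finally have main: "(mu H - r) * card X \<le> (r - card T) * card Y" .
  have "star F T = X \<union> Y" "X \<inter> Y = {}" by (auto simp: X_def Y_def star_def)
  then have split: "card (star F T) = card X + card Y" using finXY by (simp add: card_Un_disjoint)
  show ?thesis
  proof (cases "X = {}")
    case False
    then obtain A where A: "A \<in> X" by auto
    then have "T \<subseteq> A" by (auto simp: X_def star_def)
    then have "card T \<le> r"
      using F_card[OF XH(2)[OF A]] F_fin[OF XH(2)[OF A]] by (meson card_mono order_trans)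
    \<comment> \<open>Here \<open>card T \<le> r \<le> mu H\<close> ensures that no subtraction
      truncates.\<close>
    then have "mu H - card T = (mu H - r) + (r - card T)" using mu_ge by linarith
    then have "(mu H - card T) * card X = (mu H - r) * card X + (r - card T) * card X"
      by (simp add: add_mult_distrib)
    also have "\<dots> \<le> (r - card T) * card Y + (r - card T) * card X" using main by simp
    also have "\<dots> = (r - card T) * card (star F T)" by (simp add: split add_mult_distrib2)
    finally show ?thesis by (simp add: X_def)
  qed (simp add: X_def)
qed

section \<open>Comparison of \<open>F\<close> and its subfamilies with a largest
  \<open>t\<close>-star\<close>

context
  fixes L assumes L: "largest_star t F L"
begin

abbreviation "M \<equiv> m_bound r t choose (t + 1)"

lemma M_ge: "r * (r choose t) \<le> M" "r \<le> M" "0 < M"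
proof -
  show 1: "r * (r choose t) \<le> M" using mult_choose_le_m_bound_choose t by simp
  have "1 \<le> r choose t" using t by (simp add: Suc_le_eq)
  then have "r * 1 \<le> r * (r choose t)" by (rule mult_le_mono2)
  then show "r \<le> M" using 1 by linarith
  then show "0 < M" using t by linarith
qed

lemma star_le: "finite T \<Longrightarrow> card T = t \<Longrightarrow> card (star F T) \<le> card L"
  using L by (auto simp: largest_star_def is_star_def)

text \<open>Stars may be empty by definition, so a nonempty one is exhibited: a member of
  \<open>H\<close> of size at least \<open>mu H\<close> contains a set with size in
  \<open>S\<close>, which in turn contains a \<open>t\<close>-set.\<close>

lemma L_pos: "0 < card L"
proof -
  obtain A where "A \<in> H" using ne by auto
  then obtain B where B: "B \<in> H" "mu H \<le> card B" using extend by blast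
  obtain s where s: "s \<in> S" using S by auto
  then have "t \<le> s" "s \<le> card B" using S B mu_ge by fastforce+
  then obtain C where C: "C \<subseteq> B" "card C = s" by (meson obtain_subset_with_card_n)
  then obtain T where T: "T \<subseteq> C" "card T = t" using \<open>t \<le> s\<close> by (meson obtain_subset_with_card_n)
  have "C \<in> F" using B C s her by (auto simp: memF hereditary_def)
  then have "C \<in> star F T" "finite T" using T F_fin finite_subset by (auto simp: star_def)
  moreover have "finite (star F T)" using finF by (auto simp: star_def)
  ultimately show ?thesis using star_le[of T] T by (metis card_gt_0_iff empty_iff order_less_le_trans)
qed

text \<open>Dropping one point of the centre of \<open>L\<close> and exchanging it gains the factor
  \<open>(mu H - (t - 1)) / (r - t + 1)\<close>. It exceeds \<open>M\<close> strictly because the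
  summand \<open>r\<close> in \<open>n_S\<close> exceeds \<open>t - 1\<close>.\<close>

lemma F_large: "M * card L < card F"
proof -
  obtain T where T: "finite T" "card T = t" "L = star F T"
    using L by (auto simp: largest_star_def is_star_def)
  then obtain x where x: "x \<in> T" using t by fastforce
  have c: "card (T - {x}) = t - 1" using T x by simp
  have "(mu H - (t - 1)) * card L \<le> (r - (t - 1)) * card (star F (T - {x}))"
    using star_exchange[of x "T - {x}"] T x c by (simp add: insert_absorb)
  also have "\<dots> \<le> (r - (t - 1)) * card F"
    using finF by (intro mult_le_mono2 card_mono) (auto simp: star_def)
  also have "r - (t - 1) = r - t + 1" using t by simp
  finally have 1: "(mu H - (t - 1)) * card L \<le> (r - t + 1) * card F" .
  have "(r - t + 1) * M < mu H - (t - 1)" using mu_ge t by linarith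
  then have "(r - t + 1) * M * card L < (mu H - (t - 1)) * card L" using L_pos by simp
  then have "(r - t + 1) * (M * card L) < (r - t + 1) * card F" using 1 by (simp only: mult.assoc)
  then show ?thesis by (metis mult_less_cancel1)
qed

lemma L_less_F: "card L < card F"
proof -
  have "1 * card L \<le> M * card L" using M_ge(3) by (intro mult_le_mono1) linarith
  then show ?thesis using F_large by linarith
qed

lemma covered_small:
  assumes "finite \<T>" "card \<T> \<le> M" "\<And>X. X \<in> \<T> \<Longrightarrow> finite X \<and> card X = t + 1"
    and "\<And>A. A \<in> G \<Longrightarrow> A \<in> F \<and> (\<exists>X\<in>\<T>. X \<subseteq> A)"
  shows "(r - t + 1) * card G \<le> (r - t) * card L"
proof -
  \<comment> \<open>The inserted \<open>0\<close> keeps \<open>Max\<close> defined when the cover is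
    empty.\<close>
  define b where "b = Max (insert 0 ((\<lambda>X. card (star F X)) ` \<T>))"
  have le_b: "card (star F X) \<le> b" if "X \<in> \<T>" for X
    unfolding b_def using that assms(1) by (intro Max_ge) auto
  have b: "(r - t + 1) * M * b \<le> (r - t) * card L"
  proof -
    have "b \<in> insert 0 ((\<lambda>X. card (star F X)) ` \<T>)"
      unfolding b_def using assms(1) by (intro Max_in) auto
    then consider "b = 0" | X where "X \<in> \<T>" "b = card (star F X)" by auto
    then show ?thesis
    proof cases
      case 2
      then have X: "finite X" "card X = t + 1" using assms(3) by auto
      then obtain x where x: "x \<in> X" by fastforce
      then have c: "card (X - {x}) = t" using X by simp
      have "(r - t + 1) * M \<le> mu H - t" using mu_ge t by linarith
      then have "(r - t + 1) * M * b \<le> (mu H - t) * b" by (rule mult_le_mono1)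
      also have "\<dots> \<le> (r - t) * card (star F (X - {x}))"
        using star_exchange[of x "X - {x}"] X x c 2 by (simp add: insert_absorb)
      also have "\<dots> \<le> (r - t) * card L" using star_le[of "X - {x}"] c X by simp
      finally show ?thesis .
    qed simp
  qed
  have "card G \<le> card \<T> * b" using card_le_cover[OF finF assms(1) le_b assms(4)] by simp
  also have "\<dots> \<le> M * b" using assms(2) by simp
  finally have "(r - t + 1) * card G \<le> (r - t + 1) * (M * b)" by (rule mult_le_mono2)
  then show ?thesis using b by (simp only: mult.assoc)
qed

lemma t_subset_of_inter:
  assumes "A \<in> F" "t \<le> card (A \<inter> B)"
  shows "\<exists>T\<in>{T. T \<subseteq> A \<and> card T = t}. T \<subseteq> B"
proof -
  obtain T where "T \<subseteq> A \<inter> B" "card T = t" using obtain_subset_with_card_n[OF assms(2)] by metis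
  then show ?thesis by auto
qed

lemma star_le_inside: "A \<in> F \<Longrightarrow> T \<in> {T. T \<subseteq> A \<and> card T = t} \<Longrightarrow> card (star F T) \<le> card L"
  using star_le[of T] finite_subset[OF _ F_fin[of A]] by simp

lemma n_t_subsets:
  assumes "A \<in> F"
  shows "finite {T. T \<subseteq> A \<and> card T = t}" "card {T. T \<subseteq> A \<and> card T = t} \<le> r choose t"
  using F_fin[OF assms] F_card[OF assms] by (auto simp: n_subsets binomial_right_mono)

text \<open>\<open>G\<close> is covered by the stars of the at most \<open>r choose t\<close> many
  \<open>t\<close>-subsets of \<open>A\<close>, and \<open>r - t + 1 \<le> r\<close>. This will
  bound \<open>U\<^sub>1\<close>.\<close>

lemma meeting_small:
  assumes "A \<in> F" "\<And>B. B \<in> G \<Longrightarrow> B \<in> F \<and> t \<le> card (A \<inter> B)"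
  shows "(r - t + 1) * card G < card F"
proof -
  have "card G \<le> card {T. T \<subseteq> A \<and> card T = t} * card L"
    using n_t_subsets(1)[OF assms(1)] star_le_inside[OF assms(1)] t_subset_of_inter[OF assms(1)] assms(2)
    by (intro card_le_cover[OF finF]) blast+
  also have "\<dots> \<le> (r choose t) * card L" using n_t_subsets(2)[OF assms(1)] by simp
  finally have "(r - t + 1) * card G \<le> r * ((r choose t) * card L)"
    using t by (intro mult_le_mono) auto
  also have "\<dots> \<le> M * card L" using M_ge(1) by (metis mult.assoc mult_le_mono1)
  finally show ?thesis using F_large by linarith
qed

text \<open>Otherwise the \<open>t\<close>-subsets of \<open>A\<close> and of \<open>B\<close> would
  cover \<open>F\<close> by at most \<open>M\<close> stars, against \<open>F_large\<close>. It
  serves the equality case: two nonempty families cannot take part in exhausting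
  \<open>F\<close>.\<close>

lemma not_covered_by_two:
  assumes A: "A \<in> F" and B: "B \<in> F" and AB: "t \<le> card (A \<inter> B)"
  obtains C where "C \<in> F" "card (A \<inter> C) < t" "card (B \<inter> C) < t"
proof (rule ccontr)
  assume "\<not> thesis"
  then have cov: "t \<le> card (A \<inter> C) \<or> t \<le> card (B \<inter> C)" if "C \<in> F" for C
    using that \<open>\<And>C. C \<in> F \<Longrightarrow> card (A \<inter> C) < t \<Longrightarrow> card (B \<inter> C) < t \<Longrightarrow> thesis\<close>
    by (meson not_le)
  let ?sub = "\<lambda>A. {T. T \<subseteq> A \<and> card T = t}"
  have "card F \<le> card (?sub A \<union> ?sub B) * card L"
  proof (rule card_le_cover[OF finF])
    show "finite (?sub A \<union> ?sub B)" using n_t_subsets(1)[OF A] n_t_subsets(1)[OF B] by (rule finite_UnI)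
    show "card (star F T) \<le> card L" if "T \<in> ?sub A \<union> ?sub B" for T
      using that star_le_inside[OF A, of T] star_le_inside[OF B, of T] by (elim UnE)
    show "C \<in> F \<and> (\<exists>T\<in>?sub A \<union> ?sub B. T \<subseteq> C)" if "C \<in> F" for C
      using cov[OF that]
    proof
      assume "t \<le> card (A \<inter> C)"
      then show ?thesis using that t_subset_of_inter[OF A, of C] by auto
    next
      assume "t \<le> card (B \<inter> C)"
      then show ?thesis using that t_subset_of_inter[OF B, of C] by auto
    qed
  qed
  moreover have "card (?sub A \<union> ?sub B) \<le> M"
  proof -
    obtain T where "T \<in> ?sub A \<inter> ?sub B" using t_subset_of_inter[OF A AB] by blast
    then have "1 \<le> card (?sub A \<inter> ?sub B)"
      using n_t_subsets(1)[OF A] by (subst One_nat_def, intro Suc_leI) (unfold card_gt_0_iff, blast)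
    then have "card (?sub A \<union> ?sub B) + 1 \<le> 2 * (r choose t)"
      using card_Un_Int[OF n_t_subsets(1)[OF A] n_t_subsets(1)[OF B]]
        n_t_subsets(2)[OF A] n_t_subsets(2)[OF B] by linarith
    \<comment> \<open>The \<open>+ 1\<close>, which closes the case \<open>r = 1\<close>, is paid
      for by the \<open>t\<close>-subset common to \<open>A\<close> and \<open>B\<close>.\<close>
    moreover have "2 * (r choose t) \<le> r * (r choose t) + 1"
    proof (cases "r = 1")
      case True
      then show ?thesis using t by simp
    next
      case False
      then have "2 * (r choose t) \<le> r * (r choose t)" using t by (intro mult_le_mono1) linarith
      then show ?thesis by linarith
    qed
    ultimately show ?thesis using M_ge(1) by linarith
  qed
  ultimately have "card F \<le> M * card L" by (meson mult_le_mono1 order_trans)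
  then show False using F_large by simp
qed

section \<open>The weighted inequality for \<open>U\<^sub>0\<close> and
  \<open>U\<^sub>1\<close>\<close>

text \<open>After division by \<open>card F * card L\<close>, the claim concerns the sum of the
  densities of \<open>U\<^sub>0\<close> relative to \<open>L\<close> and of \<open>U\<^sub>1\<close>
  relative to \<open>F\<close>. Strictness outside the star case is what later yields the
  characterization of equality.\<close>

lemma weighted_bound:
  assumes sub: "U\<^sub>0 \<subseteq> F" "U\<^sub>1 \<subseteq> F" and disj: "U\<^sub>0 \<inter> U\<^sub>1 = {}" and U0: "U\<^sub>0 \<noteq> {}"
    and int: "\<And>A B. A \<in> U\<^sub>0 \<Longrightarrow> B \<in> U\<^sub>0 \<union> U\<^sub>1 \<Longrightarrow> t \<le> card (A \<inter> B)"
  shows "card F * card U\<^sub>0 + card L * card U\<^sub>1 < card F * card L \<or> U\<^sub>1 = {} \<and> largest_star t F U\<^sub>0"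
proof -
  have finU: "finite U\<^sub>0" "finite U\<^sub>1" using sub finF finite_subset by auto
  obtain A0 where A0: "A0 \<in> U\<^sub>0" using U0 by auto
  have U1: "(r - t + 1) * card U\<^sub>1 < card F"
    using A0 sub int[OF A0] by (intro meeting_small[of A0]) auto
  \<comment> \<open>The densities are at most \<open>(r - t) / (r - t + 1)\<close> and less than
    \<open>1 / (r - t + 1)\<close>, so their sum is below 1.\<close>
  have strict: "card F * card U\<^sub>0 + card L * card U\<^sub>1 < card F * card L"
    if *: "(r - t + 1) * card U\<^sub>0 \<le> (r - t) * card L"
  proof -
    have "(r - t + 1) * (card F * card U\<^sub>0 + card L * card U\<^sub>1)
        = card F * ((r - t + 1) * card U\<^sub>0) + card L * ((r - t + 1) * card U\<^sub>1)"
      by (simp add: algebra_simps)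
    also have "\<dots> < card F * ((r - t) * card L) + card L * card F"
      using * U1 L_pos by (intro add_le_less_mono mult_le_mono2 mult_less_mono2) auto
    also have "\<dots> = (r - t + 1) * (card F * card L)" by (simp add: algebra_simps)
    finally show ?thesis by (metis mult_less_cancel1)
  qed
  show ?thesis
  proof (cases "\<exists>T. finite T \<and> card T = t \<and> (\<forall>A\<in>U\<^sub>0. T \<subseteq> A)")
    case False
    have U0_fin: "finite A \<and> card A \<le> r" if "A \<in> U\<^sub>0" for A
      using that sub F_fin F_card by blast
    have pair: "t \<le> card (A \<inter> B)" if "A \<in> U\<^sub>0" "B \<in> U\<^sub>0" for A B using int that by blast
    have nontriv: "\<exists>A\<in>U\<^sub>0. \<not> T \<subseteq> A" if "finite T" "card T = t" for T using False that by blast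
    obtain J where J: "finite J" "card J \<le> m_bound r t" "\<forall>D\<in>U\<^sub>0. t + 1 \<le> card (D \<inter> J)"
      by (rule nontrivial_kernel[of U\<^sub>0 r t, OF U0_fin pair nontriv t(1)])
    have "(r - t + 1) * card U\<^sub>0 \<le> (r - t) * card L"
    proof (rule covered_small[of "{X. X \<subseteq> J \<and> card X = t + 1}"])
      show "finite {X. X \<subseteq> J \<and> card X = t + 1}" using J by simp
      show "card {X. X \<subseteq> J \<and> card X = t + 1} \<le> M" using J by (simp only: n_subsets binomial_right_mono)
      show "finite X \<and> card X = t + 1" if "X \<in> {X. X \<subseteq> J \<and> card X = t + 1}" for X
        using that J finite_subset by auto
      show "A \<in> F \<and> (\<exists>X\<in>{X. X \<subseteq> J \<and> card X = t + 1}. X \<subseteq> A)" if "A \<in> U\<^sub>0" for A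
      proof -
        have "t + 1 \<le> card (A \<inter> J)" using J(3) that by blast
        then obtain X where "X \<subseteq> A \<inter> J" "card X = t + 1" by (meson obtain_subset_with_card_n)
        then show ?thesis using sub that by auto
      qed
    qed
    then show ?thesis using strict by blast
  next
    case True
    then obtain T where T: "finite T" "card T = t" "\<And>A. A \<in> U\<^sub>0 \<Longrightarrow> T \<subseteq> A" by blast
    show ?thesis
    proof (cases "\<forall>B\<in>U\<^sub>1. T \<subseteq> B")
      case False
      then obtain B where B: "B \<in> U\<^sub>1" "\<not> T \<subseteq> B" by auto
      have BF: "finite B" "card B \<le> r" using B sub F_fin F_card by auto
      \<comment> \<open>A member of \<open>U\<^sub>0\<close> contains \<open>T\<close> and meets
        \<open>B\<close> in at least \<open>t\<close> points, not all of them in \<open>T\<close>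
        since \<open>B\<close> misses a point of \<open>T\<close>. Hence it contains
        \<open>T\<close> and a point of \<open>B - T\<close>.\<close>
      have "(r - t + 1) * card U\<^sub>0 \<le> (r - t) * card L"
      proof (rule covered_small[of "(\<lambda>x. insert x T) ` (B - T)"])
        show "finite ((\<lambda>x. insert x T) ` (B - T))" using BF by simp
        have "card ((\<lambda>x. insert x T) ` (B - T)) \<le> card (B - T)"
          using BF by (intro card_image_le) simp
        also have "\<dots> \<le> card B" using BF by (intro card_mono) auto
        finally show "card ((\<lambda>x. insert x T) ` (B - T)) \<le> M" using BF M_ge(2) by linarith
        show "finite X \<and> card X = t + 1" if "X \<in> (\<lambda>x. insert x T) ` (B - T)" for X
          using that T by auto
        show "A \<in> F \<and> (\<exists>X\<in>(\<lambda>x. insert x T) ` (B - T). X \<subseteq> A)" if A: "A \<in> U\<^sub>0" for A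
        proof -
          have "\<not> A \<inter> B \<subseteq> T"
          proof
            assume "A \<inter> B \<subseteq> T"
            then have "A \<inter> B = T" using int[OF A, of B] B T by (intro card_seteq) auto
            then show False using B by auto
          qed
          then show ?thesis using A T(3)[OF A] sub by auto
        qed
      qed
      then show ?thesis using strict by blast
    next
      case star: True
      have finst: "finite (star F T)" using finF by (auto simp: star_def)
      have sub_star: "U\<^sub>0 \<union> U\<^sub>1 \<subseteq> star F T" using sub star T(3) unfolding star_def by blast
      then have "card (U\<^sub>0 \<union> U\<^sub>1) \<le> card (star F T)" using finst by (intro card_mono)
      then have le: "card U\<^sub>0 + card U\<^sub>1 \<le> card (star F T)" "card (star F T) \<le> card L"
        using card_Un_disjoint[OF finU disj] star_le T by auto
      show ?thesis
      proof (cases "card U\<^sub>0 = card L")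
        case True
        then have "card U\<^sub>1 = 0" using le by linarith
        moreover have "U\<^sub>0 = star F T"
          using sub_star finst le True by (intro card_seteq) auto
        ultimately show ?thesis
          using finU L T True by (auto simp: largest_star_def is_star_def)
      next
        case False
        \<comment> \<open>Inside one star the sizes add up to at most \<open>card L\<close>, and a
          member of \<open>U\<^sub>1\<close> carries the smaller weight
          \<open>card L < card F\<close>.\<close>
        have "card F * card U\<^sub>0 + card L * card U\<^sub>1 < card F * card L"
        proof (cases "card U\<^sub>1 = 0")
          case True
          then show ?thesis using False le L_less_F by simp
        next
          case U1: False
          then have "card L * card U\<^sub>1 < card F * card U\<^sub>1" using L_less_F by simp
          then have "card F * card U\<^sub>0 + card L * card U\<^sub>1 < card F * (card U\<^sub>0 + card U\<^sub>1)"
            by (simp add: algebra_simps)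
          also have "\<dots> \<le> card F * card L" using le by (intro mult_le_mono2) linarith
          finally show ?thesis .
        qed
        then show ?thesis ..
      qed
    qed
  qed
qed

section \<open>From the weighted inequality to the sum of the sizes\<close>

text \<open>The three alternatives keep the extremal configurations visible, so that the equality
  cases can be read off.\<close>

lemma sum_bound:
  fixes k :: nat and \<A> :: "nat \<Rightarrow> 'a set set"
  defines "\<Sigma> \<equiv> (\<Sum>i=1..k. card (\<A> i))"
  assumes k: "1 \<le> k" and sub: "\<And>i. i \<in> {1..k} \<Longrightarrow> \<A> i \<subseteq> F"
    and cross: "cross_t_intersecting t k \<A>"
  shows "\<Sigma> < max (k * card L) (card F) \<or>
    \<Sigma> = k * card L \<and> (\<exists>L'. largest_star t F L' \<and> (\<forall>i\<in>{1..k}. \<A> i = L')) \<or>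
    \<Sigma> = card F \<and> (\<exists>j\<in>{1..k}. \<A> j = F \<and> (\<forall>i\<in>{1..k} - {j}. \<A> i = {}))"
proof -
  have cr: "t \<le> card (A \<inter> B)" if "i \<in> {1..k}" "j \<in> {1..k}" "i \<noteq> j" "A \<in> \<A> i" "B \<in> \<A> j" for i j A B
    using cross that unfolding cross_t_intersecting_def t_intersects_def by blast
  define U where "U = (\<Union>i\<in>{1..k}. \<A> i)"
  define U\<^sub>0 where "U\<^sub>0 = {A \<in> U. \<forall>B\<in>U. t \<le> card (A \<inter> B)}"
  define U\<^sub>1 where "U\<^sub>1 = U - U\<^sub>0"
  have UF: "U \<subseteq> F" unfolding U_def using sub by (rule UN_least)
  have finU: "finite U" "finite U\<^sub>0" "finite U\<^sub>1"
    using finite_subset[OF UF finF] by (auto simp: U\<^sub>0_def U\<^sub>1_def)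
  have finA: "finite (\<A> i)" if "i \<in> {1..k}" for i using sub[OF that] finF finite_subset by auto
  \<comment> \<open>The index of a family containing \<open>B\<close> differs from \<open>i\<close>
    or from \<open>j\<close>, so the cross condition applies to one of the two copies of
    \<open>A\<close>.\<close>
  have twice: "A \<in> U\<^sub>0" if "i \<in> {1..k}" "j \<in> {1..k}" "i \<noteq> j" "A \<in> \<A> i" "A \<in> \<A> j" for i j A
  proof -
    have "t \<le> card (A \<inter> B)" if B: "B \<in> U" for B
    proof -
      obtain l where l: "l \<in> {1..k}" "B \<in> \<A> l" using B by (auto simp: U_def)
      show ?thesis
        using cr[of i l A B] cr[of j l A B] that l \<open>i \<in> {1..k}\<close> \<open>j \<in> {1..k}\<close> \<open>i \<noteq> j\<close> \<open>A \<in> \<A> i\<close> \<open>A \<in> \<A> j\<close>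
        by (cases "l = i") auto
    qed
    then show ?thesis using that by (auto simp: U\<^sub>0_def U_def)
  qed
  have "U\<^sub>1 = (\<Union>i\<in>{1..k}. \<A> i - U\<^sub>0)" by (auto simp: U\<^sub>1_def U_def)
  then have "card U\<^sub>1 = (\<Sum>i=1..k. card (\<A> i - U\<^sub>0))"
    using finA twice by (simp only:) (rule card_UN_disjoint; fastforce)
  then have Sig: "\<Sigma> = (\<Sum>i=1..k. card (\<A> i \<inter> U\<^sub>0)) + card U\<^sub>1"
    unfolding \<Sigma>_def using sum.cong[OF refl card_Int_Diff[OF finA], of "{1..k}" "\<lambda>i. i" "\<lambda>_. U\<^sub>0"]
    by (simp add: sum.distrib)
  have Sig0: "(\<Sum>i=1..k. card (\<A> i \<inter> U\<^sub>0)) \<le> k * card U\<^sub>0"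
    using sum_bounded_above[of "{1..k}" "\<lambda>i. card (\<A> i \<inter> U\<^sub>0)" "card U\<^sub>0"] finU
    by (simp add: card_mono)
  show ?thesis
  proof (cases "U\<^sub>0 = {}")
    case True
    \<comment> \<open>No set is shared now, so the families partition \<open>U\<close>.\<close>
    then have SigU: "\<Sigma> = card U" using Sig by (simp add: U\<^sub>1_def)
    then have le: "\<Sigma> \<le> card F" using UF finF card_mono by auto
    show ?thesis
    proof (cases "\<Sigma> = card F")
      case False
      then show ?thesis using le by auto
    next
      case eq: True
      then have UeqF: "U = F" using SigU UF finF card_subset_eq by metis
      have "F \<noteq> {}" using L_less_F by auto
      then obtain j A where j: "j \<in> {1..k}" "A \<in> \<A> j" using UeqF unfolding U_def by blast
      \<comment> \<open>With a second nonempty family, every \<open>C\<close> in \<open>F\<close>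
        would lie in a family other than that of \<open>A\<close> or other than that of
        \<open>B\<close>, and so would \<open>t\<close>-intersect one of these two sets.\<close>
      have "\<A> i = {}" if i: "i \<in> {1..k} - {j}" for i
      proof (rule ccontr)
        assume "\<A> i \<noteq> {}"
        then obtain B where B: "B \<in> \<A> i" by auto
        have "A \<in> F" "B \<in> F" "t \<le> card (A \<inter> B)" using sub j i B cr[of j i A B] by auto
        then obtain C where C: "C \<in> F" "card (A \<inter> C) < t" "card (B \<inter> C) < t"
          by (rule not_covered_by_two)
        then obtain l where "l \<in> {1..k}" "C \<in> \<A> l" using UeqF by (auto simp: U_def)
        then show False
          using cr[of j l A C] cr[of i l B C] j i B C by (cases "l = j") auto
      qed
      then have emp: "\<forall>i\<in>{1..k} - {j}. \<A> i = {}" by blast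
      then have "U \<subseteq> \<A> j" by (auto simp: U_def)
      then have "\<A> j = F" using UeqF sub[OF j(1)] by blast
      then show ?thesis using eq emp j by blast
    qed
  next
    case False
    have U0_int: "t \<le> card (A \<inter> B)" if "A \<in> U\<^sub>0" "B \<in> U\<^sub>0 \<union> U\<^sub>1" for A B
      using that by (auto simp: U\<^sub>0_def U\<^sub>1_def)
    have "U\<^sub>0 \<subseteq> F" "U\<^sub>1 \<subseteq> F" "U\<^sub>0 \<inter> U\<^sub>1 = {}" using UF by (auto simp: U\<^sub>0_def U\<^sub>1_def)
    then consider (small) "card F * card U\<^sub>0 + card L * card U\<^sub>1 < card F * card L"
      | (star) "U\<^sub>1 = {}" "largest_star t F U\<^sub>0"
      using weighted_bound[OF _ _ _ False U0_int] by blast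
    then show ?thesis
    proof cases
      case small
      \<comment> \<open>Both weights, \<open>k * card L\<close> for the density of
        \<open>U\<^sub>0\<close> and \<open>card F\<close> for that of \<open>U\<^sub>1\<close>, are
        at most \<open>m\<close>, while the densities sum to less than 1.\<close>
      define m where "m = max (k * card L) (card F)"
      have m: "k * card L \<le> m" "card F \<le> m" "0 < m" using L_less_F by (auto simp: m_def)
      have "card F * card L * (card U\<^sub>1 + k * card U\<^sub>0)
          = (k * card L) * (card F * card U\<^sub>0) + card F * (card L * card U\<^sub>1)"
        by (simp add: algebra_simps)
      also have "\<dots> \<le> m * (card F * card U\<^sub>0) + m * (card L * card U\<^sub>1)"
        using m by (intro add_mono mult_le_mono1)
      also have "\<dots> = m * (card F * card U\<^sub>0 + card L * card U\<^sub>1)" by (simp add: algebra_simps)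
      also have "\<dots> < m * (card F * card L)" using small m by simp
      finally have "card F * card L * (card U\<^sub>1 + k * card U\<^sub>0) < card F * card L * m"
        by (simp add: mult.commute)
      then have "card U\<^sub>1 + k * card U\<^sub>0 < m" by (metis mult_less_cancel1)
      then show ?thesis using Sig Sig0 unfolding m_def by linarith
    next
      case star
      have cardU0: "card U\<^sub>0 = card L"
        using star L by (auto simp: largest_star_def intro: antisym)
      have AU: "\<A> i \<subseteq> U\<^sub>0" if "i \<in> {1..k}" for i
        using that star unfolding U\<^sub>1_def U_def by blast
      show ?thesis
      proof (cases "\<forall>i\<in>{1..k}. \<A> i = U\<^sub>0")
        case True
        then have "\<Sigma> = k * card L" by (simp add: \<Sigma>_def cardU0)
        then show ?thesis using True star by blast
      next
        case False
        then obtain i where i: "i \<in> {1..k}" "\<A> i \<subset> U\<^sub>0" using AU by blast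
        have "\<Sigma> < (\<Sum>i=1..k. card U\<^sub>0)"
          unfolding \<Sigma>_def
        proof (rule sum_strict_mono_ex1)
          show "\<forall>i\<in>{1..k}. card (\<A> i) \<le> card U\<^sub>0" using AU finU card_mono by blast
          show "\<exists>i\<in>{1..k}. card (\<A> i) < card U\<^sub>0" using psubset_card_mono[OF finU(2) i(2)] i(1) ..
        qed simp
        then show ?thesis by (simp add: cardU0 less_max_iff_disj)
      qed
    qed
  qed
qed

end

end

section \<open>Assembly of the bound and the equality cases\<close>

text \<open>When \<open>a\<close> and \<open>b\<close> differ, the configuration with the smaller
  value cannot attain the maximum; when they agree, both attain it.\<close>

lemma max_dichotomy:
  fixes s a b :: nat
  assumes "P \<longrightarrow> s = a" "Q \<longrightarrow> s = b" "s < max a b \<or> s = a \<and> P \<or> s = b \<and> Q"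
  shows "s \<le> max a b \<and> (s = max a b \<longleftrightarrow> (b < a \<and> P) \<or> (b > a \<and> Q) \<or> (b = a \<and> (P \<or> Q)))"
  using assms by (cases P; cases Q) (auto simp: max_def split: if_splits)

theorem theorem2p1:
  fixes t r k :: nat
    and H F L :: "'a set set"
    and S :: "nat set"
    and \<A> :: "nat \<Rightarrow> 'a set set"
  assumes "1 \<le> t" and "t \<le> r" and "1 \<le> k"
    and "finite H" and "\<forall>A\<in>H. finite A"
    and "hereditary H"
    and "n_S r t \<le> mu H"
    and "S \<noteq> {}" and "S \<subseteq> {t..r}"
    and "F = (\<Union>s\<in>S. level H s)"
    and "\<forall>i\<in>{1..k}. \<A> i \<subseteq> F"
    and "cross_t_intersecting t k \<A>"
    and "largest_star t F L"
  shows "(\<Sum>i=1..k. card (\<A> i)) \<le> max (k * card L) (card F) \<and>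
    ((\<Sum>i=1..k. card (\<A> i)) = max (k * card L) (card F) \<longleftrightarrow>
      (card F < k * card L \<and> (\<exists>L'. largest_star t F L' \<and> (\<forall>i\<in>{1..k}. \<A> i = L'))) \<or>
      (card F > k * card L \<and> (\<exists>j\<in>{1..k}. \<A> j = F \<and> (\<forall>i\<in>{1..k} - {j}. \<A> i = {}))) \<or>
      (card F = k * card L \<and>
        ((\<exists>L'. largest_star t F L' \<and> (\<forall>i\<in>{1..k}. \<A> i = L')) \<or>
         (\<exists>j\<in>{1..k}. \<A> j = F \<and> (\<forall>i\<in>{1..k} - {j}. \<A> i = {})))))"
proof -
  let ?\<Sigma> = "\<Sum>i=1..k. card (\<A> i)"
  let ?P = "\<exists>L'. largest_star t F L' \<and> (\<forall>i\<in>{1..k}. \<A> i = L')"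
  let ?Q = "\<exists>j\<in>{1..k}. \<A> j = F \<and> (\<forall>i\<in>{1..k} - {j}. \<A> i = {})"
  have P: "?P \<longrightarrow> ?\<Sigma> = k * card L"
  proof
    assume asm: ?P
    obtain L' where L': "largest_star t F L'" "\<forall>i\<in>{1..k}. \<A> i = L'" using asm by blast
    then have "card L' = card L"
      using \<open>largest_star t F L\<close> by (auto simp: largest_star_def intro: antisym)
    then show "?\<Sigma> = k * card L" using L' by simp
  qed
  have Q: "?Q \<longrightarrow> ?\<Sigma> = card F"
  proof
    assume asm: ?Q
    obtain j where j: "j \<in> {1..k}" "\<A> j = F" "\<forall>i\<in>{1..k} - {j}. \<A> i = {}" using asm by blast
    have "?\<Sigma> = card (\<A> j) + (\<Sum>i\<in>{1..k} - {j}. card (\<A> i))"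
      using j by (intro sum.remove) auto
    then show "?\<Sigma> = card F" using j by simp
  qed
  have "?\<Sigma> < max (k * card L) (card F) \<or> ?\<Sigma> = k * card L \<and> ?P \<or> ?\<Sigma> = card F \<and> ?Q"
  proof (cases "H = {}")
    case True
    \<comment> \<open>The empty family has no base, so \<open>mu\<close> says nothing here; all
      families equal \<open>F = {}\<close>, and any index \<open>j\<close> works.\<close>
    then have "F = {}" using assms by (simp add: level_def)
    then show ?thesis using assms by auto
  next
    case False
    interpret large_hereditary H F S r t
      using assms False by unfold_locales auto
    show ?thesis using sum_bound[of L k \<A>] assms by blast
  qed
  then show ?thesis by (rule max_dichotomy[OF P Q])
qed

end
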